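(* Let $M$ and $M'$ be $n$-layered models over a signature $\Delta^n$ and let $S=(S_k)_{k\in\{0,\dots,n\}}$ be an $n$-layered simulation from $M$ to $M'$. Then for every $k\in\{0,\dots,n\}$, every $(w_0,\dots,w_k)$ and $(w'_0,\dots,w'_k)$ with $(w_0,\dots,w_k)S_k(w'_0,\dots,w'_k)$, and every $\varphi\in SFm^+(k,\Delta^n)$, \[M_k,w_0,\dots,w_k\models_k\varphi\quad\text{implies}\quad M'_k,w'_0,\dots,w'_k\models_k\varphi.\]
   Context: Notation. For $P\subseteq S_0\times\dots\times S_n$ and $k\le n$, $P|_k\subseteq S_0\times\dots\times S_k$ is the set of $(s_0,\dots,s_k)$ such that $(s_0,\dots,s_n)\in P$ for some $s_{k+1},\dots,s_n$. Signatures. An $n$-layered signature $\Delta^n=(\mathrm{Prop}_k,\mathrm{Nom}_k)_{k\in\{0,\dots,n\}}$ is a family of pairwise disjoint, possibly empty, sets of propositions $p_k\in\mathrm{Prop}_k$ and nominals $i_k\in\mathrm{Nom}_k$. Positive strict formulas. For $k\in\{0,\dots,n\}$, $SFm^+(k,\Delta^n)$ is the set of formulas generated by $\varphi::= p_k\mid i_k\mid\varphi\wedge\varphi\mid @_{i_k}\varphi\mid\Diamond_k\varphi$ with $p_k\in\mathrm{Prop}_k$, $i_k\in\mathrm{Nom}_k$ (no negation). Models. An $n$-layered model $M=(W^n,D^n,R^n,V^n)$ over $\Delta^n$ consists of: pairwise disjoint sets $W_0,\dots,W_n$; a predicate $D^n\subseteq W_0\times\dots\times W_n$ such that, writing $D_k=D^n|_k$,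 for each $k$, $W_k=\{v_k\mid (w_0,\dots,w_{k-1},v_k)\in D_k\text{ for some }(w_0,\dots,w_{k-1})\in D_{k-1}\}$; relations $R_k\subseteq D_k\times D_k$ ($k\le n$); valuations $V^{\mathrm{Prop}}_0:\mathrm{Prop}_0\to\mathcal P(W_0)$, $V^{\mathrm{Prop}}_k:\mathrm{Prop}_k\times D_{k-1}\to\mathcal P(W_k)$ for $k\ge1$, and $V^{\mathrm{Nom}}_k:\mathrm{Nom}_k\to W_k$. The $k$-restriction $M_k$ keeps only the components of levels $\le k$ (with $D_k$ in place of $D^n$). Primed symbols denote the components of $M'$. Satisfaction. For $(w_0,\dots,w_k)\in D_k$: - $p_k$: holds iff $w_0\in V^{\mathrm{Prop}}_0(p_0)$ when $k=0$, and iff $w_k\in V^{\mathrm{Prop}}_k(p_k,(w_0,\dots,w_{k-1}))$ when $k\ge1$; - $i_k$: iff $w_k=V^{\mathrm{Nom}}_k(i_k)$ and $(w_0,\dots,w_{k-1},V^{\mathrm{Nom}}_k(i_k))\in D_k$; - $\wedge$: as usual; - $@_{i_k}\varphi$: iff $(w_0,\dots,w_{k-1},V^{\mathrm{Nom}}_k(i_k))\in D_k$ and $M_k,w_0,\dots,w_{k-1},V^{\mathrm{Nom}}_k(i_k)\models_k\varphi$; - $\Diamond_k\varphi$: iff there is $(v_0,\dots,v_k)$ with $(w_0,\dots,w_k)R_k(v_0,\dots,v_k)$ and $M_k,v_0,\dots,v_k\models_k\varphi$. $n$-layered simulation. A family $S=(S_k\subseteq D_k\times D'_k)_{k\in\{0,\dots,n\}}$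 is an $n$-layered simulation from $M$ to $M'$ if for every $k$ and every $(w_0,\dots,w_k)S_k(w'_0,\dots,w'_k)$: (ATOM$_k$) 1. for each $p_k\in\mathrm{Prop}_k$: if $k=0$, $w_0\in V^{\mathrm{Prop}}_0(p_0)$ implies $w'_0\in V'^{\mathrm{Prop}}_0(p_0)$; if $k\ge1$, $w_k\in V^{\mathrm{Prop}}_k(p_k,(w_0,\dots,w_{k-1}))$ implies $w'_k\in V'^{\mathrm{Prop}}_k(p_k,(w'_0,\dots,w'_{k-1}))$. 2. for each $i_k\in\mathrm{Nom}_k$: (i) if $k=0$, $V^{\mathrm{Nom}}_0(i_0)\,S_0\,V'^{\mathrm{Nom}}_0(i_0)$; if $k\ge1$, $(w_0,\dots,w_{k-1},V^{\mathrm{Nom}}_k(i_k))\,S_k\,(w'_0,\dots,w'_{k-1},V'^{\mathrm{Nom}}_k(i_k))$; (ii) [$w_k=V^{\mathrm{Nom}}_k(i_k)$ and $(w_0,\dots,w_{k-1},V^{\mathrm{Nom}}_k(i_k))\in D_k$] implies [$w'_k=V'^{\mathrm{Nom}}_k(i_k)$ and $(w'_0,\dots,w'_{k-1},V'^{\mathrm{Nom}}_k(i_k))\in D'_k$]. (ZIG$_k$) for all $(v_0,\dots,v_k)$ with $(w_0,\dots,w_k)R_k(v_0,\dots,v_k)$ there is $(v'_0,\dots,v'_k)$ with $(w'_0,\dots,w'_k)R'_k(v'_0,\dots,v'_k)$ and $(v_0,\dots,v_k)S_k(v'_0,\dots,v'_k)$. *)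

theory Defs
  imports "HOL-Library.Disjoint_Sets"
begin

text \<open>
  A tuple \<open>(w\<^sub>0, \<dots>, w\<^sub>k)\<close> is the list \<open>[w\<^sub>0, \<dots>, w\<^sub>k]\<close> of length \<open>Suc k\<close>. The tuple of length 0,
  \<open>[]\<close>, plays the role of the absent prefix \<open>(w\<^sub>0, \<dots>, w\<^bsub>k-1\<^esub>)\<close> at level \<open>k = 0\<close>; this merges the
  separate clauses for \<open>k = 0\<close> and \<open>k \<ge> 1\<close>.
\<close>

definition tuples :: "(nat \<Rightarrow> 'w set) \<Rightarrow> nat \<Rightarrow> 'w list set" where
  "tuples W n = {ws. length ws = Suc n \<and> (\<forall>k\<le>n. ws ! k \<in> W k)}"

definition tuple_restrict :: "'w list set \<Rightarrow> nat \<Rightarrow> 'w list set" where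
  "tuple_restrict P k = take (Suc k) ` P"


record 's signature =
  Props :: "nat \<Rightarrow> 's set"
  Noms :: "nat \<Rightarrow> 's set"

definition is_signature :: "nat \<Rightarrow> 's signature \<Rightarrow> bool" where
  "is_signature n \<Delta> \<longleftrightarrow>
     disjoint_family_on (Props \<Delta>) {..n} \<and>
     disjoint_family_on (Noms \<Delta>) {..n} \<and>
     (\<forall>k\<le>n. \<forall>l\<le>n. Props \<Delta> k \<inter> Noms \<Delta> l = {})"


datatype 's fm =
    Prp 's
  | Nml 's
  | Conj "'s fm" "'s fm"
  | At 's "'s fm"
  | Dia nat "'s fm"

inductive_set SFm :: "nat \<Rightarrow> 's signature \<Rightarrow> 's fm set"
  for k :: nat and \<Delta> :: "'s signature" where
  Prp: "p \<in> Props \<Delta> k \<Longrightarrow> Prp p \<in> SFm k \<Delta>"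
| Nml: "i \<in> Noms \<Delta> k \<Longrightarrow> Nml i \<in> SFm k \<Delta>"
| Conj: "\<phi> \<in> SFm k \<Delta> \<Longrightarrow> \<psi> \<in> SFm k \<Delta> \<Longrightarrow> Conj \<phi> \<psi> \<in> SFm k \<Delta>"
| At: "i \<in> Noms \<Delta> k \<Longrightarrow> \<phi> \<in> SFm k \<Delta> \<Longrightarrow> At i \<phi> \<in> SFm k \<Delta>"
| Dia: "\<phi> \<in> SFm k \<Delta> \<Longrightarrow> Dia k \<phi> \<in> SFm k \<Delta>"


text \<open>
  \<open>VProp M k p ws\<close> is the valuation of \<open>p\<close> at level \<open>k\<close> relative to the prefix \<open>ws\<close> of length \<open>k\<close>;
  in particular \<open>VProp M 0 p []\<close> is the subset of \<open>W\<^sub>0\<close> assigned to \<open>p\<close>.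
\<close>

record ('s, 'w) model =
  World :: "nat \<Rightarrow> 'w set"
  Dom :: "'w list set"
  Rel :: "nat \<Rightarrow> ('w list \<times> 'w list) set"
  VProp :: "nat \<Rightarrow> 's \<Rightarrow> 'w list \<Rightarrow> 'w set"
  VNom :: "nat \<Rightarrow> 's \<Rightarrow> 'w"

definition dom_at :: "('s, 'w) model \<Rightarrow> nat \<Rightarrow> 'w list set" where
  "dom_at M k = tuple_restrict (Dom M) k"

definition prefixes_at :: "('s, 'w) model \<Rightarrow> nat \<Rightarrow> 'w list set" where
  "prefixes_at M k = (if k = 0 then {[]} else dom_at M (k - 1))"

definition is_model :: "nat \<Rightarrow> 's signature \<Rightarrow> ('s, 'w) model \<Rightarrow> bool" where
  "is_model n \<Delta> M \<longleftrightarrow>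
     disjoint_family_on (World M) {..n} \<and>
     Dom M \<subseteq> tuples (World M) n \<and>
     (\<forall>k\<le>n. World M k = {v. \<exists>ws\<in>prefixes_at M k. ws @ [v] \<in> dom_at M k}) \<and>
     (\<forall>k\<le>n. Rel M k \<subseteq> dom_at M k \<times> dom_at M k) \<and>
     (\<forall>k\<le>n. \<forall>p\<in>Props \<Delta> k. \<forall>ws\<in>prefixes_at M k. VProp M k p ws \<subseteq> World M k) \<and>
     (\<forall>k\<le>n. \<forall>i\<in>Noms \<Delta> k. VNom M k i \<in> World M k)"

text \<open>The \<open>k\<close>-restriction \<open>M\<^sub>k\<close>: components of level above \<open>k\<close> are erased to dummy values.\<close>

definition model_restrict :: "('s, 'w) model \<Rightarrow> nat \<Rightarrow> ('s, 'w) model" where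
  "model_restrict M k =
     \<lparr>World = (\<lambda>j. if j \<le> k then World M j else {}),
      Dom = dom_at M k,
      Rel = (\<lambda>j. if j \<le> k then Rel M j else {}),
      VProp = (\<lambda>j. if j \<le> k then VProp M j else (\<lambda>_ _. {})),
      VNom = (\<lambda>j. if j \<le> k then VNom M j else (\<lambda>_. undefined))\<rparr>"


text \<open>
  \<open>sat k N ws \<phi>\<close> is \<open>N, w\<^sub>0, \<dots>, w\<^sub>k \<Turnstile>\<^sub>k \<phi>\<close> for a \<open>k\<close>-layered model \<open>N\<close>, a tuple \<open>ws\<close> in \<open>dom_at N k\<close>
  and \<open>\<phi>\<close> of level \<open>k\<close>. It is meant to be used with \<open>N = model_restrict M k\<close>.
\<close>

primrec sat :: "nat \<Rightarrow> ('s, 'w) model \<Rightarrow> 'w list \<Rightarrow> 's fm \<Rightarrow> bool" where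
  "sat k N ws (Prp p) \<longleftrightarrow> ws ! k \<in> VProp N k p (take k ws)"
| "sat k N ws (Nml i) \<longleftrightarrow> ws ! k = VNom N k i \<and> take k ws @ [VNom N k i] \<in> dom_at N k"
| "sat k N ws (Conj \<phi> \<psi>) \<longleftrightarrow> sat k N ws \<phi> \<and> sat k N ws \<psi>"
| "sat k N ws (At i \<phi>) \<longleftrightarrow>
     take k ws @ [VNom N k i] \<in> dom_at N k \<and> sat k N (take k ws @ [VNom N k i]) \<phi>"
| "sat k N ws (Dia j \<phi>) \<longleftrightarrow> (\<exists>vs. (ws, vs) \<in> Rel N j \<and> sat k N vs \<phi>)"


definition sim_atom_prop ::
  "'s signature \<Rightarrow> ('s, 'w) model \<Rightarrow> ('s, 'v) model \<Rightarrow> nat \<Rightarrow> 'w list \<Rightarrow> 'v list \<Rightarrow> bool" where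
  "sim_atom_prop \<Delta> M M' k ws ws' \<longleftrightarrow>
     (\<forall>p\<in>Props \<Delta> k.
        ws ! k \<in> VProp M k p (take k ws) \<longrightarrow> ws' ! k \<in> VProp M' k p (take k ws'))"

definition sim_atom_nom ::
  "'s signature \<Rightarrow> ('s, 'w) model \<Rightarrow> ('s, 'v) model \<Rightarrow> (nat \<Rightarrow> ('w list \<times> 'v list) set) \<Rightarrow>
   nat \<Rightarrow> 'w list \<Rightarrow> 'v list \<Rightarrow> bool" where
  "sim_atom_nom \<Delta> M M' S k ws ws' \<longleftrightarrow>
     (\<forall>i\<in>Noms \<Delta> k.
        (take k ws @ [VNom M k i], take k ws' @ [VNom M' k i]) \<in> S k \<and>
        (ws ! k = VNom M k i \<and> take k ws @ [VNom M k i] \<in> dom_at M k \<longrightarrow>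
         ws' ! k = VNom M' k i \<and> take k ws' @ [VNom M' k i] \<in> dom_at M' k))"

definition sim_zig ::
  "('s, 'w) model \<Rightarrow> ('s, 'v) model \<Rightarrow> (nat \<Rightarrow> ('w list \<times> 'v list) set) \<Rightarrow>
   nat \<Rightarrow> 'w list \<Rightarrow> 'v list \<Rightarrow> bool" where
  "sim_zig M M' S k ws ws' \<longleftrightarrow>
     (\<forall>vs. (ws, vs) \<in> Rel M k \<longrightarrow> (\<exists>vs'. (ws', vs') \<in> Rel M' k \<and> (vs, vs') \<in> S k))"

definition is_simulation ::
  "nat \<Rightarrow> 's signature \<Rightarrow> ('s, 'w) model \<Rightarrow> ('s, 'v) model \<Rightarrow>
   (nat \<Rightarrow> ('w list \<times> 'v list) set) \<Rightarrow> bool" where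
  "is_simulation n \<Delta> M M' S \<longleftrightarrow>
     (\<forall>k\<le>n. S k \<subseteq> dom_at M k \<times> dom_at M' k \<and>
        (\<forall>(ws, ws')\<in>S k.
           sim_atom_prop \<Delta> M M' k ws ws' \<and>
           sim_atom_nom \<Delta> M M' S k ws ws' \<and>
           sim_zig M M' S k ws ws'))"

end

theory Submission
  imports Defs
begin

text \<open>Induction on the positive formula at a fixed level \<open>k\<close>, where truth at
  level \<open>k\<close> consults only level-\<open>k\<close> data, which
  \<open>model_restrict\<close> keeps. Each simulation clause pushes one constructor forward: ATOM
  handles propositions, nominals and \<open>At\<close>, ZIG handles \<open>Dia\<close>. Without
  negation, one-directional clauses suffice (\<open>sat_simulation\<close>).\<close>

lemma dom_at_restrict [simp]: "dom_at (model_restrict M k) k = dom_at M k"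
  by (simp add: dom_at_def tuple_restrict_def model_restrict_def image_image)

lemma model_restrict_sel [simp]:
  "VProp (model_restrict M k) k = VProp M k"
  "VNom (model_restrict M k) k = VNom M k"
  "Rel (model_restrict M k) k = Rel M k"
  by (simp_all add: model_restrict_def)

lemma sat_simulation:
  assumes sim: "is_simulation n \<Delta> M M' S" and k: "k \<le> n"
    and "\<phi> \<in> SFm k \<Delta>" and "(ws, ws') \<in> S k" and "sat k (model_restrict M k) ws \<phi>"
  shows "sat k (model_restrict M' k) ws' \<phi>"
  using assms(3-5)
\<comment> \<open>The pair must vary: \<open>At\<close> and \<open>Dia\<close> evaluate the
  subformula at another related pair.\<close>
proof (induction arbitrary: ws ws' rule: SFm.induct)
  case (Prp p)
  then have "sim_atom_prop \<Delta> M M' k ws ws'"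
    using sim k by (auto simp: is_simulation_def)
  with Prp show ?case
    by (simp add: sim_atom_prop_def)
next
  case (Nml i)
  then have "sim_atom_nom \<Delta> M M' S k ws ws'"
    using sim k by (auto simp: is_simulation_def)
  with Nml show ?case
    by (simp add: sim_atom_nom_def)
next
  case (Conj \<phi> \<psi>)
  then show ?case
    by auto
next
  case (At i \<phi>)
  then have "sim_atom_nom \<Delta> M M' S k ws ws'"
    using sim k by (auto simp: is_simulation_def)
  \<comment> \<open>Jumping to a nominal preserves \<open>S k\<close> wherever the jump starts, so
    the induction hypothesis applies at the new pair.\<close>
  with At.hyps have S: "(take k ws @ [VNom M k i], take k ws' @ [VNom M' k i]) \<in> S k"
    by (simp add: sim_atom_nom_def)
  \<comment> \<open>This supplies the other half of \<open>At\<close>: the target tuple exists in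
    \<open>M'\<close>.\<close>
  moreover have "S k \<subseteq> dom_at M k \<times> dom_at M' k"
    using sim k by (simp add: is_simulation_def)
  ultimately show ?case
    using At.IH[OF S] At.prems by auto
next
  case (Dia \<phi>)
  then have "sim_zig M M' S k ws ws'"
    using sim k by (auto simp: is_simulation_def)
  with Dia.IH Dia.prems show ?case
    by (fastforce simp: sim_zig_def)
qed

theorem theorem3:
  fixes n :: nat
    and \<Delta> :: "'s signature"
    and M :: "('s, 'w) model"
    and M' :: "('s, 'v) model"
    and S :: "nat \<Rightarrow> ('w list \<times> 'v list) set"
  assumes "is_signature n \<Delta>"
    and "is_model n \<Delta> M"
    and "is_model n \<Delta> M'"
    and "is_simulation n \<Delta> M M' S"
  shows "\<forall>k\<le>n. \<forall>ws ws'. (ws, ws') \<in> S k \<longrightarrow>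
           (\<forall>\<phi>\<in>SFm k \<Delta>.
              sat k (model_restrict M k) ws \<phi> \<longrightarrow> sat k (model_restrict M' k) ws' \<phi>)"
  using sat_simulation[OF assms(4)] by blast

end
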